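(* Let $\Omega\subset\mathbb{R}^3$ be the open unit ball, let $\gamma\in C^2(\overline\Omega)$ be a positive function with $\gamma=1$ in a neighborhood of $\partial\Omega$, and let $q=\gamma^{-1/2}\Delta\gamma^{1/2}$, extended by $0$ to $\mathbb{R}^3$. Let $\mathbf{t}$ and $\mathbf{t}^{\mathrm{exp}}$ be the scattering transform of $q$ and its exponential approximation, as defined in the context. Suppose $q$ is real-valued and even, i.e. $q(-x)=q(x)$. Then for all $\xi\in\mathbb{R}^3$ and $\zeta\in\mathcal{V}_\xi$, $$\overline{\mathbf{t}(\xi,\zeta)}=\mathbf{t}(\xi,\overline\zeta)\ \ (\text{for } \zeta\text{ admissible}),\qquad \overline{\mathbf{t}^{\mathrm{exp}}(\xi,\zeta)}=\mathbf{t}^{\mathrm{exp}}(\xi,\overline\zeta).$$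
   Context: For $a,b\in\mathbb{C}^3$, $a\cdot b=\sum_j a_jb_j$ (bilinear, no conjugation), $a^2=a\cdot a$, and $|a|$ is the Hermitian norm. Set $\mathcal{V}=\{\zeta\in\mathbb{C}^3\setminus\{0\}:\zeta\cdot\zeta=0\}$ and, for $\xi\in\mathbb{R}^3$, $\mathcal{V}_\xi=\{\zeta\in\mathcal{V}:(\xi+\zeta)^2=0\}$. Complex geometrical optics solutions: for $\zeta\in\mathcal{V}$ let $g_\zeta(x)=\frac{1}{(2\pi)^3}\int_{\mathbb{R}^3}\frac{e^{ix\cdot\eta}}{|\eta|^2+2\eta\cdot\zeta}\,d\eta$, understood as the inverse Fourier transform of a tempered distribution. Fix $\delta\in(-1,0)$ and let $L^2_\delta(\mathbb{R}^3)$ be the weighted space with norm $\left(\int(1+|x|^2)^\delta|f(x)|^2dx\right)^{1/2}$. Call $\zeta\in\mathcal{V}$ admissible if the equation $\mu+g_\zeta*(q\mu)=1$ in $\mathbb{R}^3$ has a unique solution $\mu=\mu(\cdot,\zeta)$ with $\mu-1\in L^2_\delta(\mathbb{R}^3)$; in that case set $\psi(x,\zeta)=e^{ix\cdot\zeta}\mu(x,\zeta)$. Scattering transform: for $\xi\in\mathbb{R}^3$ and admissible $\zeta\in\mathcal{V}$, $$\mathbf{t}(\xi,\zeta)=\int_\Omega e^{-ix\cdot(\xi+\zeta)}\psi(x,\zeta)q(x)\,dx .$$ Dirichlet-to-Neumann map: $\Lambda_q f=\partial v/\partial\nu|_{\partial\Omega}$, where $(-\Delta+q)v=0$ in $\Omega$,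 $v|_{\partial\Omega}=f$, and $\nu$ is the outward unit normal; $\Lambda_0$ is the same map with $q=0$. For $\xi\in\mathbb{R}^3$, $\zeta\in\mathcal{V}_\xi$, $$\mathbf{t}^{\mathrm{exp}}(\xi,\zeta)=\int_{\partial\Omega}e^{-ix\cdot(\xi+\zeta)}\big[(\Lambda_q-\Lambda_0)e^{i(\cdot)\cdot\zeta}\big](x)\,d\sigma(x).$$ *)

theory Defs
  imports "HOL-Analysis.Analysis"
begin

section \<open>Complex vectors\<close>

notation scalar_product (infixl \<open>\<bullet>\<^sub>c\<close> 70)

definition cvec :: "real ^ 3 \<Rightarrow> complex ^ 3"
  where "cvec x = (\<chi> j. complex_of_real (x $ j))"

definition vcnj :: "complex ^ 3 \<Rightarrow> complex ^ 3"
  where "vcnj \<zeta> = (\<chi> j. cnj (\<zeta> $ j))"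

definition \<V> :: "(complex ^ 3) set"
  where "\<V> = {\<zeta>. \<zeta> \<noteq> 0 \<and> \<zeta> \<bullet>\<^sub>c \<zeta> = 0}"

definition \<V>_at :: "real ^ 3 \<Rightarrow> (complex ^ 3) set"
  where "\<V>_at \<xi> = {\<zeta> \<in> \<V>. (cvec \<xi> + \<zeta>) \<bullet>\<^sub>c (cvec \<xi> + \<zeta>) = 0}"


section \<open>Partial derivatives and function spaces\<close>

definition pd :: "3 \<Rightarrow> (real ^ 3 \<Rightarrow> 'b::real_normed_vector) \<Rightarrow> real ^ 3 \<Rightarrow> 'b"
  where "pd j f x = frechet_derivative f (at x) (axis j 1)"

text \<open>Multi-indices are lists of coordinate directions.\<close>

definition pds :: "3 list \<Rightarrow> (real ^ 3 \<Rightarrow> 'b::real_normed_vector) \<Rightarrow> real ^ 3 \<Rightarrow> 'b"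
  where "pds js f = foldr pd js f"

definition laplacian :: "(real ^ 3 \<Rightarrow> 'b::real_normed_vector) \<Rightarrow> real ^ 3 \<Rightarrow> 'b"
  where "laplacian f x = (\<Sum>j\<in>UNIV. pd j (pd j f) x)"

definition smooth :: "(real ^ 3 \<Rightarrow> complex) \<Rightarrow> bool"
  where "smooth \<phi> \<longleftrightarrow> (\<forall>js x. pds js \<phi> differentiable (at x))"

definition test_functions :: "(real ^ 3) set \<Rightarrow> (real ^ 3 \<Rightarrow> complex) set"
  where "test_functions U =
    {\<phi>. smooth \<phi> \<and> (\<exists>K. compact K \<and> K \<subseteq> U \<and> (\<forall>x. x \<notin> K \<longrightarrow> \<phi> x = 0))}"

definition schwartz :: "(real ^ 3 \<Rightarrow> complex) set"
  where "schwartz =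
    {\<phi>. smooth \<phi> \<and> (\<forall>js (k::nat). bounded (range (\<lambda>x. norm x ^ k *\<^sub>R pds js \<phi> x)))}"

text \<open>
  \<open>C\<^sup>2\<close> on the closed unit ball: twice continuously differentiable in the open ball, the
  function and its derivatives of order at most two extending continuously to the closed ball.
\<close>

definition C2_closed_ball :: "(real ^ 3 \<Rightarrow> real) \<Rightarrow> bool"
  where "C2_closed_ball f \<longleftrightarrow>
    continuous_on (cball 0 1) f \<and>
    (\<forall>js. length js \<le> 1 \<longrightarrow> (\<forall>x\<in>ball 0 1. pds js f differentiable (at x))) \<and>
    (\<forall>js. length js \<le> 2 \<longrightarrow>
      (\<exists>g. continuous_on (cball 0 1) g \<and> (\<forall>x\<in>ball 0 1. g x = pds js f x)))"

definition potential :: "(real ^ 3 \<Rightarrow> real) \<Rightarrow> real ^ 3 \<Rightarrow> real"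
  where "potential \<gamma> x =
    (if x \<in> ball 0 1 then \<gamma> x powr (- (1/2)) * laplacian (\<lambda>y. \<gamma> y powr (1/2)) x else 0)"

definition weighted_L2 :: "real \<Rightarrow> (real ^ 3 \<Rightarrow> complex) set"
  where "weighted_L2 \<delta> =
    {f \<in> borel_measurable lborel.
      integrable lborel (\<lambda>x. (1 + (norm x)\<^sup>2) powr \<delta> * (norm (f x))\<^sup>2)}"


section \<open>Distributions\<close>

text \<open>
  A tempered distribution is represented by its action on functions; only its values on Schwartz
  functions are meaningful.
\<close>

type_synonym distribution = "(real ^ 3 \<Rightarrow> complex) \<Rightarrow> complex"

definition regular_dist :: "(real ^ 3 \<Rightarrow> complex) \<Rightarrow> distribution"
  where "regular_dist f \<phi> = (LINT x|lborel. f x * \<phi> x)"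

definition inverse_fourier :: "(real ^ 3 \<Rightarrow> complex) \<Rightarrow> real ^ 3 \<Rightarrow> complex"
  where "inverse_fourier \<phi> x =
    1 / (2 * pi) ^ 3 * (LINT \<eta>|lborel. exp (\<i> * complex_of_real (x \<bullet> \<eta>)) * \<phi> \<eta>)"

definition inverse_fourier_dist :: "distribution \<Rightarrow> distribution"
  where "inverse_fourier_dist T \<phi> = T (inverse_fourier \<phi>)"

text \<open>
  Convolution of a distribution with a compactly supported integrable function, by duality:
  \<open>\<langle>T * f, \<phi>\<rangle> = \<langle>T, y \<mapsto> \<integral> f(x) \<phi>(x + y) dx\<rangle>\<close>.
\<close>

definition conv_dist :: "distribution \<Rightarrow> (real ^ 3 \<Rightarrow> complex) \<Rightarrow> distribution"
  where "conv_dist T f \<phi> = T (\<lambda>y. LINT x|lborel. f x * \<phi> (x + y))"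


section \<open>Complex geometrical optics solutions and the scattering transform\<close>

text \<open>
  For \<open>\<zeta> \<in> \<V>\<close> the denominator of the symbol vanishes transversally on a circle, so the symbol is
  locally integrable; together with its boundedness at infinity this makes it a regular tempered
  distribution. The value on the circle is immaterial.
\<close>

definition faddeev_symbol :: "complex ^ 3 \<Rightarrow> real ^ 3 \<Rightarrow> complex"
  where "faddeev_symbol \<zeta> \<eta> = 1 / (complex_of_real ((norm \<eta>)\<^sup>2) + 2 * (cvec \<eta> \<bullet>\<^sub>c \<zeta>))"

definition faddeev_green :: "complex ^ 3 \<Rightarrow> distribution"
  where "faddeev_green \<zeta> = inverse_fourier_dist (regular_dist (faddeev_symbol \<zeta>))"

text \<open>
  The equation \<open>\<mu> + g\<^sub>\<zeta> * (q \<mu>) = 1\<close> is an identity of tempered distributions.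
\<close>

definition cgo_solution ::
    "real \<Rightarrow> (real ^ 3 \<Rightarrow> real) \<Rightarrow> complex ^ 3 \<Rightarrow> (real ^ 3 \<Rightarrow> complex) \<Rightarrow> bool"
  where "cgo_solution \<delta> q \<zeta> \<mu> \<longleftrightarrow>
    (\<lambda>x. \<mu> x - 1) \<in> weighted_L2 \<delta> \<and>
    (\<forall>\<phi>\<in>schwartz.
      regular_dist \<mu> \<phi> + conv_dist (faddeev_green \<zeta>) (\<lambda>x. of_real (q x) * \<mu> x) \<phi>
        = regular_dist (\<lambda>_. 1) \<phi>)"

text \<open>Uniqueness is uniqueness in \<open>L\<^sup>2\<^sub>\<delta>\<close>, that is, up to null sets.\<close>

definition admissible :: "real \<Rightarrow> (real ^ 3 \<Rightarrow> real) \<Rightarrow> complex ^ 3 \<Rightarrow> bool"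
  where "admissible \<delta> q \<zeta> \<longleftrightarrow>
    \<zeta> \<in> \<V> \<and>
    (\<exists>\<mu>. cgo_solution \<delta> q \<zeta> \<mu>) \<and>
    (\<forall>\<mu>\<^sub>1 \<mu>\<^sub>2. cgo_solution \<delta> q \<zeta> \<mu>\<^sub>1 \<longrightarrow> cgo_solution \<delta> q \<zeta> \<mu>\<^sub>2 \<longrightarrow>
      (AE x in lborel. \<mu>\<^sub>1 x = \<mu>\<^sub>2 x))"

text \<open>For admissible \<open>\<zeta>\<close> this picks a representative of the unique solution.\<close>

definition cgo_mu :: "real \<Rightarrow> (real ^ 3 \<Rightarrow> real) \<Rightarrow> complex ^ 3 \<Rightarrow> real ^ 3 \<Rightarrow> complex"
  where "cgo_mu \<delta> q \<zeta> = (SOME \<mu>. cgo_solution \<delta> q \<zeta> \<mu>)"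

definition cgo_psi :: "real \<Rightarrow> (real ^ 3 \<Rightarrow> real) \<Rightarrow> complex ^ 3 \<Rightarrow> real ^ 3 \<Rightarrow> complex"
  where "cgo_psi \<delta> q \<zeta> x = exp (\<i> * (cvec x \<bullet>\<^sub>c \<zeta>)) * cgo_mu \<delta> q \<zeta> x"

definition scattering_transform ::
    "real \<Rightarrow> (real ^ 3 \<Rightarrow> real) \<Rightarrow> real ^ 3 \<Rightarrow> complex ^ 3 \<Rightarrow> complex"
  where "scattering_transform \<delta> q \<xi> \<zeta> =
    (LINT x : ball 0 1 | lborel.
      exp (- (\<i> * (cvec x \<bullet>\<^sub>c (cvec \<xi> + \<zeta>)))) * cgo_psi \<delta> q \<zeta> x * of_real (q x))"


section \<open>Dirichlet-to-Neumann map and the exponential approximation\<close>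

text \<open>
  Since \<open>q\<close> is merely continuous, a solution of \<open>(- \<Delta> + q) v = 0\<close> need not be \<open>C\<^sup>2\<close>; the equation
  is understood in the sense of distributions, the boundary condition classically.
\<close>

definition dirichlet_solution ::
    "(real ^ 3 \<Rightarrow> real) \<Rightarrow> (real ^ 3 \<Rightarrow> complex) \<Rightarrow> (real ^ 3 \<Rightarrow> complex) \<Rightarrow> bool"
  where "dirichlet_solution q f v \<longleftrightarrow>
    continuous_on (cball 0 1) v \<and>
    (\<forall>x\<in>sphere 0 1. v x = f x) \<and>
    (\<forall>\<phi>\<in>test_functions (ball 0 1).
      (LINT x : ball 0 1 | lborel. v x * (- laplacian \<phi> x + of_real (q x) * \<phi> x)) = 0)"

text \<open>
  Outward normal derivative at a point \<open>x\<close> of the unit sphere, where \<open>\<nu> = x\<close>, taken from inside.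
\<close>

definition has_normal_derivative :: "(real ^ 3 \<Rightarrow> complex) \<Rightarrow> complex \<Rightarrow> real ^ 3 \<Rightarrow> bool"
  where "has_normal_derivative v d x \<longleftrightarrow>
    ((\<lambda>s. v (x + s *\<^sub>R x)) has_vector_derivative d) (at_left 0)"

text \<open>
  The pointwise Dirichlet-to-Neumann map. For smooth \<open>f\<close> and \<open>q\<close> the potential of a conductivity
  equal to one near the sphere, the solution is unique and, being harmonic near the sphere, smooth
  up to it, so that the first case applies at every point of the sphere. Elsewhere the value is
  fixed to be zero.
\<close>

definition dn_map ::
    "(real ^ 3 \<Rightarrow> real) \<Rightarrow> (real ^ 3 \<Rightarrow> complex) \<Rightarrow> real ^ 3 \<Rightarrow> complex"
  where "dn_map q f x =
    (if x \<in> sphere 0 1 \<and> (\<exists>!d. \<exists>v. dirichlet_solution q f v \<and> has_normal_derivative v d x)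
     then THE d. \<exists>v. dirichlet_solution q f v \<and> has_normal_derivative v d x
     else 0)"

text \<open>
  Surface measure of the unit sphere: \<open>\<sigma>(E)\<close> is three times the volume of the cone
  \<open>{x. 0 < |x| < 1 \<and> x / |x| \<in> E}\<close>.
\<close>

definition sphere_measure :: "(real ^ 3) measure"
  where "sphere_measure =
    scale_measure 3 (distr (restrict_space lborel (ball 0 1 - {0})) borel (\<lambda>x. x /\<^sub>R norm x))"

lemma emeasure_sphere_measure: "emeasure sphere_measure (sphere 0 1) = ennreal (4 * pi)"
proof -
  let ?B = "ball 0 1 - {0} :: (real ^ 3) set"
  let ?R = "restrict_space lborel ?B"
  let ?h = "\<lambda>x :: real ^ 3. x /\<^sub>R norm x"
  have m: "?h \<in> ?R \<rightarrow>\<^sub>M borel"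
    by (rule measurable_restrict_space1) simp
  have "?h -` sphere 0 1 \<inter> space ?R = ?B"
    by (auto simp: space_restrict_space)
  then have "emeasure (distr ?R borel ?h) (sphere 0 1) = emeasure ?R ?B"
    using m by (simp add: emeasure_distr)
  also have "\<dots> = emeasure lborel ?B"
    by (simp add: emeasure_restrict_space)
  also have "\<dots> = emeasure lborel (ball (0 :: real ^ 3) 1)"
    by (subst emeasure_Diff) auto
  also have "\<dots> = ennreal (4 / 3 * pi)"
    by (simp add: emeasure_ball unit_ball_vol_3)
  finally show ?thesis
    by (simp add: sphere_measure_def flip: ennreal_mult'' ennreal_numeral)
qed

definition scattering_exp :: "(real ^ 3 \<Rightarrow> real) \<Rightarrow> real ^ 3 \<Rightarrow> complex ^ 3 \<Rightarrow> complex"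
  where "scattering_exp q \<xi> \<zeta> =
    (LINT x | sphere_measure.
      exp (- (\<i> * (cvec x \<bullet>\<^sub>c (cvec \<xi> + \<zeta>)))) *
      (dn_map q (\<lambda>y. exp (\<i> * (cvec y \<bullet>\<^sub>c \<zeta>))) x
        - dn_map (\<lambda>_. 0) (\<lambda>y. exp (\<i> * (cvec y \<bullet>\<^sub>c \<zeta>))) x))"

end

theory Submission
  imports Defs
begin

text \<open>
  Write \<open>f\<^sup>*(x)\<close> for the conjugate of \<open>f(-x)\<close>. For real even \<open>q\<close> this operation intertwines
  every object attached to \<open>\<zeta>\<close> with the one attached to the conjugate of \<open>\<zeta>\<close>: the inverse
  Fourier transform turns it into pointwise conjugation, which acts on the symbol of \<open>g\<^sub>\<zeta>\<close> by
  conjugating \<open>\<zeta>\<close>; it sends the exponential \<open>exp (i x \<cdot> \<zeta>)\<close> to the one with conjugate parameter;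
  and it preserves solutions of \<open>(- \<Delta> + q) v = 0\<close>. By uniqueness it maps \<open>\<mu>(\<cdot>, \<zeta>)\<close> to \<open>\<mu>\<close> with
  the conjugate parameter, and the two identities follow by substituting \<open>-x\<close> for \<open>x\<close> in the
  conjugated integrals.
\<close>

definition cnj_reflect :: "('a::uminus \<Rightarrow> complex) \<Rightarrow> 'a \<Rightarrow> complex"
  where "cnj_reflect f x = cnj (f (- x))"

lemma cnj_reflect_involution [simp]:
  fixes f :: "'a::group_add \<Rightarrow> complex"
  shows "cnj_reflect (cnj_reflect f) = f"
  by (simp add: cnj_reflect_def fun_eq_iff)

lemma borel_measurable_cnj [measurable (raw)]:
  "f \<in> borel_measurable M \<Longrightarrow> (\<lambda>x. cnj (f x)) \<in> borel_measurable M"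
  by (rule borel_measurable_continuous_on[OF continuous_on_cnj[OF continuous_on_id]])

lemma borel_measurable_cnj_reflect [measurable]:
  fixes f :: "real ^ 3 \<Rightarrow> complex"
  assumes [measurable]: "f \<in> borel_measurable borel"
  shows "cnj_reflect f \<in> borel_measurable borel"
proof -
  have [measurable]: "(uminus :: real ^ 3 \<Rightarrow> real ^ 3) \<in> borel_measurable borel"
    by (intro borel_measurable_continuous_onI continuous_intros)
  show ?thesis
    unfolding cnj_reflect_def by measurable
qed


section \<open>Integrals invariant under an involution\<close>

text \<open>An involution composes integrability in both directions, so \<open>f\<close> and its
  composite are integrable together. When they are not, both integrals take the default value 0.
  Hence any integrand may be reflected without regularity assumptions, in particular one containing
  \<open>dn_map\<close>.\<close>

lemma
  fixes f :: "'a \<Rightarrow> 'b::{banach, second_countable_topology}"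
  assumes \<sigma> [measurable]: "\<sigma> \<in> M \<rightarrow>\<^sub>M M" and inv: "distr M M \<sigma> = M" and invol: "\<And>x. \<sigma> (\<sigma> x) = x"
  shows integrable_involution: "integrable M (\<lambda>x. f (\<sigma> x)) \<longleftrightarrow> integrable M f"
    and integral_involution: "(LINT x|M. f (\<sigma> x)) = (LINT x|M. f x)"
proof -
  have dir: "integrable M (\<lambda>x. g (\<sigma> x))" if "integrable M g" for g :: "'a \<Rightarrow> 'b"
    using integrable_distr[OF \<sigma>, of g] that inv by simp
  show iff: "integrable M (\<lambda>x. f (\<sigma> x)) \<longleftrightarrow> integrable M f"
    using dir[of f] dir[of "\<lambda>x. f (\<sigma> x)"] by (auto simp: invol)
  show "(LINT x|M. f (\<sigma> x)) = (LINT x|M. f x)"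
  proof (cases "integrable M f")
    case True
    then show ?thesis
      using integral_distr[OF \<sigma>, of f] by (simp add: inv)
  next
    case False
    then show ?thesis
      using iff by (simp add: not_integrable_integral_eq)
  qed
qed

text \<open>Affine change of variables with factor -1: the Jacobian has modulus 1, so the density in
  \<open>lborel_affine\<close> is trivial.\<close>

lemma distr_lborel_uminus: "distr lborel lborel uminus = (lborel :: 'a::euclidean_space measure)"
proof -
  have "distr lborel lborel uminus = distr lborel borel (uminus :: 'a \<Rightarrow> 'a)"
    by (rule distr_cong) auto
  then show ?thesis
    using lborel_affine[of "-1" "0 :: 'a"] by (simp add: density_1)
qed

lemma
  fixes f :: "'a::euclidean_space \<Rightarrow> 'b::{banach, second_countable_topology}"
  shows lborel_integrable_reflect: "integrable lborel (\<lambda>x. f (- x)) \<longleftrightarrow> integrable lborel f"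
    and lborel_integral_reflect: "(LINT x|lborel. f (- x)) = (LINT x|lborel. f x)"
  using integrable_involution[of uminus lborel f] integral_involution[of uminus lborel f]
  by (simp_all add: distr_lborel_uminus)

lemma lborel_integral_cnj_reflect:
  fixes f :: "'a::euclidean_space \<Rightarrow> complex"
  shows "(LINT x|lborel. cnj (f (- x))) = cnj (LINT x|lborel. f x)"
  using lborel_integral_reflect[of "\<lambda>x. cnj (f x)"] by simp

lemma set_lborel_integral_cnj_reflect:
  fixes f :: "'a::euclidean_space \<Rightarrow> complex"
  assumes "uminus ` S = S"
  shows "(LINT x:S|lborel. cnj (f (- x))) = cnj (LINT x:S|lborel. f x)"
proof -
  have "- x \<in> S \<longleftrightarrow> x \<in> S" for x
    using assms by (metis imageI minus_minus)
  then have "indicator S x *\<^sub>R cnj (f (- x)) = cnj (indicator S (- x) *\<^sub>R f (- x))" for x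
    by (simp add: indicator_def)
  then show ?thesis
    using lborel_integral_cnj_reflect[of "\<lambda>x. indicator S x *\<^sub>R f x"]
    by (simp only: set_lebesgue_integral_def)
qed

lemma uminus_ball_0 [simp]: "uminus ` ball 0 r = (ball 0 r :: 'a::real_normed_vector set)"
  by (auto simp: image_iff intro!: bexI[where x="- _"])

text \<open>The radial projection is odd and the punctured ball symmetric, so the cone over the
  antipodal image of a set is the reflected cone, which has the same Lebesgue measure.\<close>

lemma distr_sphere_measure_uminus: "distr sphere_measure sphere_measure uminus = sphere_measure"
proof (rule measure_eqI)
  let ?B = "ball 0 1 - {0} :: (real ^ 3) set"
  let ?R = "restrict_space lborel ?B"
  let ?h = "\<lambda>x :: real ^ 3. x /\<^sub>R norm x"
  have sets: "sets sphere_measure = sets borel"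
    by (simp add: sphere_measure_def)
  have space: "space sphere_measure = UNIV"
    by (simp add: sphere_measure_def space_scale_measure)
  have m: "?h \<in> ?R \<rightarrow>\<^sub>M borel"
    by (rule measurable_restrict_space1) simp
  have emeasure: "emeasure sphere_measure A = 3 * emeasure lborel (?h -` A \<inter> ?B)"
    if "A \<in> sets borel" for A
  proof -
    have "emeasure (distr ?R borel ?h) A = emeasure ?R (?h -` A \<inter> ?B)"
      using m that by (simp add: emeasure_distr space_restrict_space)
    then show ?thesis
      by (simp add: sphere_measure_def emeasure_restrict_space)
  qed
  show "sets (distr sphere_measure sphere_measure uminus) = sets sphere_measure"
    by simp
  fix A
  assume "A \<in> sets (distr sphere_measure sphere_measure uminus)"
  then have A [measurable]: "A \<in> sets borel"
    by (simp add: sets)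
  have minus: "uminus \<in> sphere_measure \<rightarrow>\<^sub>M sphere_measure"
    by (simp add: measurable_cong_sets[OF sets sets])
  have A': "uminus -` A \<in> sets borel"
    using measurable_sets_borel[OF _ A, of uminus] by simp
  have C: "?h -` A \<inter> ?B \<in> sets lborel"
    using measurable_sets_borel[OF _ A, of ?h] by simp
  have "emeasure (distr sphere_measure sphere_measure uminus) A
      = 3 * emeasure lborel (?h -` (uminus -` A) \<inter> ?B)"
    using minus A A' by (simp add: emeasure_distr sets space emeasure)
  also have "?h -` (uminus -` A) \<inter> ?B = uminus -` (?h -` A \<inter> ?B)"
    by auto
  also have "emeasure lborel \<dots> = emeasure (distr lborel lborel uminus) (?h -` A \<inter> ?B)"
    using C by (simp add: emeasure_distr)
  also have "\<dots> = emeasure lborel (?h -` A \<inter> ?B)"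
    by (simp only: distr_lborel_uminus)
  finally show "emeasure (distr sphere_measure sphere_measure uminus) A = emeasure sphere_measure A"
    using A by (simp add: emeasure)
qed

lemma sphere_integral_cnj_reflect:
  "(LINT x|sphere_measure. cnj (f (- x))) = cnj (LINT x|sphere_measure. f x)"
proof -
  have "uminus \<in> sphere_measure \<rightarrow>\<^sub>M sphere_measure"
    by (simp add: sphere_measure_def cong: measurable_cong_sets)
  from integral_involution[OF this distr_sphere_measure_uminus, of "\<lambda>x. cnj (f x)"]
  show ?thesis by simp
qed


section \<open>Reflection of derivatives, test functions and Schwartz functions\<close>

lemma has_derivative_imp_pd: "(f has_derivative D) (at x) \<Longrightarrow> pd j f x = D (axis j 1)"
  by (simp add: pd_def frechet_derivative_at[symmetric])

text \<open>The chain rule contributes one factor -1. The constant \<open>c\<close> carries the sign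
  collected by earlier derivatives, so that the rule can be iterated along a multi-index.\<close>

lemma
  assumes "f differentiable (at (- x))"
  shows pd_cnj_reflect: "pd j (\<lambda>y. c * cnj_reflect f y) x = - c * cnj_reflect (pd j f) x"
    and differentiable_cnj_reflect: "(\<lambda>y. c * cnj_reflect f y) differentiable (at x)"
proof -
  obtain D where D: "(f has_derivative D) (at (- x))"
    using assms by (auto simp: differentiable_def)
  have "((\<lambda>y. f (- y)) has_derivative (\<lambda>h. D (- h))) (at x)"
    by (rule has_derivative_compose[where f=uminus and g=f, OF _ D]) (auto intro!: derivative_eq_intros)
  then have *: "((\<lambda>y. c * cnj_reflect f y) has_derivative (\<lambda>h. c * cnj (D (- h)))) (at x)"
    unfolding cnj_reflect_def
    by (intro has_derivative_mult_right has_derivative_cnj)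
  show "(\<lambda>y. c * cnj_reflect f y) differentiable (at x)"
    using * by (auto simp: differentiable_def)
  have "D (- axis j 1) = - D (axis j 1)"
    using has_derivative_linear[OF D] by (rule linear_neg)
  then show "pd j (\<lambda>y. c * cnj_reflect f y) x = - c * cnj_reflect (pd j f) x"
    using has_derivative_imp_pd[OF *] has_derivative_imp_pd[OF D] by (simp add: cnj_reflect_def)
qed

lemma pds_cnj_reflect:
  assumes "smooth f"
  shows "pds js (cnj_reflect f) = (\<lambda>x. (- 1) ^ length js * cnj_reflect (pds js f) x)"
proof (induction js)
  case Nil
  then show ?case by (simp add: pds_def)
next
  case (Cons j js)
  have "pds (j # js) (cnj_reflect f) x = (- 1) ^ length (j # js) * cnj_reflect (pds (j # js) f) x"
    for x
  proof -
    have "pds (j # js) (cnj_reflect f) x = pd j (pds js (cnj_reflect f)) x"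
      by (simp add: pds_def)
    also have "\<dots> = - ((- 1) ^ length js) * cnj_reflect (pd j (pds js f)) x"
      unfolding Cons using assms by (intro pd_cnj_reflect) (simp add: smooth_def)
    finally show ?thesis
      by (simp add: pds_def)
  qed
  then show ?case ..
qed

lemma smooth_cnj_reflect: "smooth f \<Longrightarrow> smooth (cnj_reflect f)"
  using differentiable_cnj_reflect[where c="(- 1) ^ _"] by (auto simp: smooth_def pds_cnj_reflect)

text \<open>Each term has order two, so the signs cancel.\<close>

lemma laplacian_cnj_reflect:
  assumes "smooth f"
  shows "laplacian (cnj_reflect f) x = cnj_reflect (laplacian f) x"
  using pds_cnj_reflect[OF assms, of "[j, j]" for j]
  by (simp add: laplacian_def pds_def cnj_reflect_def)

lemma test_functions_cnj_reflect:
  assumes "\<phi> \<in> test_functions U" and "uminus ` U = U"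
  shows "cnj_reflect \<phi> \<in> test_functions U"
proof -
  from assms obtain K where K: "smooth \<phi>" "compact K" "K \<subseteq> U" "\<And>x. x \<notin> K \<Longrightarrow> \<phi> x = 0"
    by (auto simp: test_functions_def)
  have "compact (uminus ` K)"
    using K(2) by (rule compact_negations)
  moreover have "uminus ` K \<subseteq> U"
    using K(3) assms(2) by blast
  moreover have "cnj_reflect \<phi> x = 0" if "x \<notin> uminus ` K" for x
    using that K(4)[of "- x"] by (force simp: cnj_reflect_def image_iff)
  ultimately show ?thesis
    using smooth_cnj_reflect[OF K(1)] by (auto simp: test_functions_def)
qed

lemma schwartz_cnj_reflect:
  assumes "\<phi> \<in> schwartz"
  shows "cnj_reflect \<phi> \<in> schwartz"
proof -
  have smooth: "smooth \<phi>"
    and bdd: "bounded (range (\<lambda>x. norm x ^ k *\<^sub>R pds js \<phi> x))" for k js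
    using assms by (auto simp: schwartz_def)
  have "bounded (range (\<lambda>x. norm x ^ k *\<^sub>R pds js (cnj_reflect \<phi>) x))" for k js
  proof -
    obtain B where B: "\<And>x. norm (norm x ^ k *\<^sub>R pds js \<phi> x) \<le> B"
      using bdd[of k js] by (auto simp: bounded_iff)
    \<comment> \<open>The bound at \<open>-x\<close> serves at \<open>x\<close>: the norm is even,
      and neither the sign nor the conjugation changes the modulus.\<close>
    have "norm (norm x ^ k *\<^sub>R pds js (cnj_reflect \<phi>) x) \<le> B" for x
      using B[of "- x"]
      by (simp add: pds_cnj_reflect[OF smooth] cnj_reflect_def norm_mult norm_power)
    then show ?thesis
      by (auto simp: bounded_iff)
  qed
  then show ?thesis
    using smooth_cnj_reflect[OF smooth] by (simp add: schwartz_def)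
qed


section \<open>Complex geometrical optics solutions\<close>

lemma vcnj_vcnj [simp]: "vcnj (vcnj \<zeta>) = \<zeta>"
  by (simp add: vcnj_def vec_eq_iff)

lemma cvec_uminus_scalar_product [simp]: "cvec (- x) \<bullet>\<^sub>c \<zeta> = - (cvec x \<bullet>\<^sub>c \<zeta>)"
  by (simp add: cvec_def scalar_product_def sum_negf)

lemma cvec_scalar_product_uminus: "cvec x \<bullet>\<^sub>c (- \<zeta>) = - (cvec x \<bullet>\<^sub>c \<zeta>)"
  by (simp add: scalar_product_def sum_negf)

lemma cnj_cvec_scalar_product: "cnj (cvec x \<bullet>\<^sub>c \<zeta>) = cvec x \<bullet>\<^sub>c vcnj \<zeta>"
  by (simp add: cvec_def vcnj_def scalar_product_def)

lemma vcnj_cvec [simp]: "vcnj (cvec x) = cvec x"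
  by (simp add: cvec_def vcnj_def vec_eq_iff)

lemma vcnj_add: "vcnj (a + b) = vcnj a + vcnj b"
  by (simp add: vcnj_def vec_eq_iff)

lemma vcnj_in_\<V>:
  assumes "\<zeta> \<in> \<V>"
  shows "vcnj \<zeta> \<in> \<V>"
proof -
  have "vcnj \<zeta> \<bullet>\<^sub>c vcnj \<zeta> = cnj (\<zeta> \<bullet>\<^sub>c \<zeta>)"
    by (simp add: vcnj_def scalar_product_def)
  moreover have "vcnj \<zeta> \<noteq> 0"
    using assms by (auto simp: \<V>_def vcnj_def vec_eq_iff)
  ultimately show ?thesis
    using assms by (simp add: \<V>_def)
qed

section \<open>Conjugate reflection of distributions and of the integral equation\<close>

lemma regular_dist_cnj_reflect:
  "regular_dist (cnj_reflect f) (cnj_reflect \<phi>) = cnj (regular_dist f \<phi>)"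
  using lborel_integral_cnj_reflect[of "\<lambda>x. f x * \<phi> x"]
  by (simp add: regular_dist_def cnj_reflect_def)

text \<open>Conjugation flips the sign in the exponent and substituting \<open>-\<eta>\<close> flips
  it back. This uses up the reflection, leaving the point \<open>x\<close> fixed.\<close>

lemma inverse_fourier_cnj_reflect:
  "inverse_fourier (cnj_reflect \<phi>) x = cnj (inverse_fourier \<phi> x)"
  using lborel_integral_cnj_reflect[of "\<lambda>\<eta>. exp (\<i> * complex_of_real (x \<bullet> \<eta>)) * \<phi> \<eta>"]
  by (simp add: inverse_fourier_def cnj_reflect_def exp_cnj)

lemma faddeev_symbol_vcnj: "faddeev_symbol (vcnj \<zeta>) \<eta> = cnj (faddeev_symbol \<zeta> \<eta>)"
  by (simp add: faddeev_symbol_def cnj_cvec_scalar_product)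

text \<open>On the frequency side the symbol and the transformed test function are both conjugated
  at the same point, so no change of variables is needed.\<close>

lemma faddeev_green_cnj_reflect:
  "faddeev_green (vcnj \<zeta>) (cnj_reflect \<phi>) = cnj (faddeev_green \<zeta> \<phi>)"
  by (simp add: faddeev_green_def inverse_fourier_dist_def regular_dist_def
      inverse_fourier_cnj_reflect faddeev_symbol_vcnj flip: complex_cnj_mult)

lemma conv_dist_cnj_reflect:
  "conv_dist (faddeev_green (vcnj \<zeta>)) (cnj_reflect f) (cnj_reflect \<phi>)
    = cnj (conv_dist (faddeev_green \<zeta>) f \<phi>)"
proof -
  have "(\<lambda>y. LINT x|lborel. cnj_reflect f x * cnj_reflect \<phi> (x + y))
      = cnj_reflect (\<lambda>y. LINT x|lborel. f x * \<phi> (x + y))"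
  proof
    fix y
    show "(LINT x|lborel. cnj_reflect f x * cnj_reflect \<phi> (x + y))
        = cnj_reflect (\<lambda>y. LINT x|lborel. f x * \<phi> (x + y)) y"
      \<comment> \<open>Reflecting in \<open>y\<close> produces \<open>\<phi> (x - y)\<close>;
        substituting \<open>-x\<close> then gives the argument \<open>-(x + y)\<close>, as required
        by \<open>cnj_reflect \<phi> (x + y)\<close>.\<close>
      using lborel_integral_cnj_reflect[of "\<lambda>x. f x * \<phi> (x - y)"]
      by (simp add: cnj_reflect_def)
  qed
  then show ?thesis
    by (simp add: conv_dist_def faddeev_green_cnj_reflect)
qed

text \<open>The weight is radial and conjugation preserves the modulus.\<close>

lemma weighted_L2_cnj_reflect:
  assumes "f \<in> weighted_L2 \<delta>"
  shows "cnj_reflect f \<in> weighted_L2 \<delta>"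
  using assms
    lborel_integrable_reflect[of "\<lambda>x. (1 + (norm x)\<^sup>2) powr \<delta> * (norm (f x))\<^sup>2"]
    borel_measurable_cnj_reflect[of f]
  by (simp add: weighted_L2_def cnj_reflect_def)

text \<open>The equation for \<open>\<mu>\<close> is tested against
  \<open>cnj_reflect \<phi>\<close>, again a Schwartz function, and then conjugated. The potential
  passes through because it is real and even.\<close>

lemma cgo_solution_cnj_reflect:
  assumes even: "\<forall>x. q (- x) = q x" and sol: "cgo_solution \<delta> q \<zeta> \<mu>"
  shows "cgo_solution \<delta> q (vcnj \<zeta>) (cnj_reflect \<mu>)"
proof -
  have "cnj_reflect (\<lambda>x. \<mu> x - 1) \<in> weighted_L2 \<delta>"
    using sol by (intro weighted_L2_cnj_reflect) (simp add: cgo_solution_def)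
  moreover have "regular_dist (cnj_reflect \<mu>) \<phi> +
      conv_dist (faddeev_green (vcnj \<zeta>)) (\<lambda>x. of_real (q x) * cnj_reflect \<mu> x) \<phi>
      = regular_dist (\<lambda>_. 1) \<phi>" if "\<phi> \<in> schwartz" for \<phi>
  proof -
    let ?\<phi> = "cnj_reflect \<phi>"
    have q\<mu>: "(\<lambda>x. of_real (q x) * cnj_reflect \<mu> x) = cnj_reflect (\<lambda>x. of_real (q x) * \<mu> x)"
      by (simp add: cnj_reflect_def even fun_eq_iff)
    \<comment> \<open>The right-hand side of the equation is its own conjugate reflection, so the
      new equation has the same source term.\<close>
    have one: "(\<lambda>_. 1) = cnj_reflect (\<lambda>_ :: real ^ 3. 1)"
      by (simp add: cnj_reflect_def fun_eq_iff)
    have "regular_dist \<mu> ?\<phi> + conv_dist (faddeev_green \<zeta>) (\<lambda>x. of_real (q x) * \<mu> x) ?\<phi>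
        = regular_dist (\<lambda>_. 1) ?\<phi>"
      using sol schwartz_cnj_reflect[OF that] by (simp add: cgo_solution_def)
    from arg_cong[OF this, of cnj] show ?thesis
      unfolding q\<mu>
      by (subst one) (simp add: regular_dist_cnj_reflect[symmetric] conv_dist_cnj_reflect[symmetric])
  qed
  ultimately show ?thesis
    by (auto simp: cgo_solution_def cnj_reflect_def[abs_def])
qed

text \<open>The operation is an involution, so two solutions for \<open>vcnj \<zeta>\<close> are
  carried back to solutions for \<open>\<zeta>\<close>, where uniqueness applies.\<close>

lemma admissible_vcnj:
  assumes even: "\<forall>x. q (- x) = q x" and adm: "admissible \<delta> q \<zeta>"
  shows "admissible \<delta> q (vcnj \<zeta>)"
proof -
  have "AE x in lborel. \<mu>\<^sub>1 x = \<mu>\<^sub>2 x"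
    if "cgo_solution \<delta> q (vcnj \<zeta>) \<mu>\<^sub>1" "cgo_solution \<delta> q (vcnj \<zeta>) \<mu>\<^sub>2" for \<mu>\<^sub>1 \<mu>\<^sub>2
  proof -
    have "cgo_solution \<delta> q \<zeta> (cnj_reflect \<mu>\<^sub>1)" "cgo_solution \<delta> q \<zeta> (cnj_reflect \<mu>\<^sub>2)"
      using that cgo_solution_cnj_reflect[OF even, where \<zeta>="vcnj \<zeta>"] by simp_all
    then have "AE x in lborel. cnj_reflect \<mu>\<^sub>1 x = cnj_reflect \<mu>\<^sub>2 x"
      using adm by (simp add: admissible_def)
    then have ae: "AE x in lborel. \<mu>\<^sub>1 (- x) = \<mu>\<^sub>2 (- x)"
      by (simp add: cnj_reflect_def)
    \<comment> \<open>Equality is known at \<open>-x\<close> for almost every \<open>x\<close>;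
      reflection invariance of Lebesgue measure removes the sign.\<close>
    have "AE x in distr lborel lborel uminus. \<mu>\<^sub>1 (- x) = \<mu>\<^sub>2 (- x)"
      using ae by (simp only: distr_lborel_uminus)
    then have "AE x in lborel. \<mu>\<^sub>1 (- (- x)) = \<mu>\<^sub>2 (- (- x))"
      by (rule AE_distrD[rotated]) simp
    then show ?thesis
      by simp
  qed
  moreover have "\<exists>\<mu>. cgo_solution \<delta> q (vcnj \<zeta>) \<mu>"
    using adm cgo_solution_cnj_reflect[OF even] unfolding admissible_def by blast
  ultimately show ?thesis
    using adm vcnj_in_\<V> by (simp add: admissible_def)
qed

lemma cgo_solution_cgo_mu: "admissible \<delta> q \<zeta> \<Longrightarrow> cgo_solution \<delta> q \<zeta> (cgo_mu \<delta> q \<zeta>)"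
  unfolding cgo_mu_def admissible_def by (metis someI_ex)

lemma cgo_solution_borel_measurable:
  assumes "cgo_solution \<delta> q \<zeta> \<mu>"
  shows "\<mu> \<in> borel_measurable borel"
proof -
  have "(\<lambda>x. (\<mu> x - 1) + 1) \<in> borel_measurable borel"
    using assms by (intro borel_measurable_add) (auto simp: cgo_solution_def weighted_L2_def)
  then show ?thesis
    by simp
qed

text \<open>Both sides solve the equation with parameter \<open>vcnj \<zeta>\<close>. Only almost
  everywhere equality can be expected, since \<open>cgo_mu\<close> chooses a representative
  separately for each parameter.\<close>

lemma AE_cgo_mu_vcnj:
  assumes even: "\<forall>x. q (- x) = q x" and adm: "admissible \<delta> q \<zeta>"
  shows "AE x in lborel. cgo_mu \<delta> q (vcnj \<zeta>) x = cnj_reflect (cgo_mu \<delta> q \<zeta>) x"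
  using admissible_vcnj[OF assms] cgo_solution_cgo_mu[OF admissible_vcnj[OF assms]]
    cgo_solution_cnj_reflect[OF even cgo_solution_cgo_mu[OF adm]]
  unfolding admissible_def by blast

section \<open>Conjugating the scattering transform\<close>

lemma borel_measurable_exp_cvec [measurable]:
  "(\<lambda>x. exp (\<i> * (cvec x \<bullet>\<^sub>c \<zeta>))) \<in> borel_measurable borel"
  unfolding cvec_def scalar_product_def
  by (intro borel_measurable_continuous_onI continuous_intros)

lemma cnj_reflect_exp_cvec:
  "cnj_reflect (\<lambda>x. exp (\<i> * (cvec x \<bullet>\<^sub>c \<zeta>))) = (\<lambda>x. exp (\<i> * (cvec x \<bullet>\<^sub>c vcnj \<zeta>)))"
  by (simp add: cnj_reflect_def fun_eq_iff exp_cnj cnj_cvec_scalar_product)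

lemma cnj_exp_cvec_uminus:
  "cnj (exp (- (\<i> * (cvec (- x) \<bullet>\<^sub>c (cvec \<xi> + \<zeta>))))) = exp (- (\<i> * (cvec x \<bullet>\<^sub>c (cvec \<xi> + vcnj \<zeta>))))"
  by (simp add: exp_cnj cnj_cvec_scalar_product vcnj_add)

lemma cnj_scattering_transform:
  assumes even: "\<forall>x. q (- x) = q x" and adm: "admissible \<delta> q \<zeta>"
    and q [measurable]: "q \<in> borel_measurable borel"
  shows "cnj (scattering_transform \<delta> q \<xi> \<zeta>) = scattering_transform \<delta> q \<xi> (vcnj \<zeta>)"
proof -
  let ?e = "\<lambda>\<zeta> x. exp (- (\<i> * (cvec x \<bullet>\<^sub>c (cvec \<xi> + \<zeta>))))"
  let ?f = "\<lambda>\<zeta> \<mu> x. ?e \<zeta> x * (exp (\<i> * (cvec x \<bullet>\<^sub>c \<zeta>)) * \<mu> x) * complex_of_real (q x)"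
  have e [measurable]: "?e \<zeta> \<in> borel_measurable borel" for \<zeta>
    using borel_measurable_exp_cvec[of "- (cvec \<xi> + \<zeta>)"]
    by (simp only: cvec_scalar_product_uminus mult_minus_right)
  have [simp]: "cgo_mu \<delta> q \<zeta> \<in> borel_measurable borel"
      "cgo_mu \<delta> q (vcnj \<zeta>) \<in> borel_measurable borel"
    using cgo_solution_cgo_mu[OF adm] cgo_solution_cgo_mu[OF admissible_vcnj[OF even adm]]
    by (auto intro: cgo_solution_borel_measurable)
  have meas: "(\<lambda>x. indicator (ball 0 1) x *\<^sub>R ?f \<zeta> \<mu> x) \<in> borel_measurable lborel"
    if [measurable]: "\<mu> \<in> borel_measurable borel" for \<zeta> \<mu>
    by (intro borel_measurable_scaleR borel_measurable_times borel_measurable_indicator) simp_all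
  have "cnj (scattering_transform \<delta> q \<xi> \<zeta>)
      = (LINT x:ball 0 1|lborel. cnj (?f \<zeta> (cgo_mu \<delta> q \<zeta>) (- x)))"
    unfolding scattering_transform_def cgo_psi_def
    by (rule set_lborel_integral_cnj_reflect[OF uminus_ball_0, symmetric])
  also have "\<dots> = (LINT x:ball 0 1|lborel. ?f (vcnj \<zeta>) (cnj_reflect (cgo_mu \<delta> q \<zeta>)) x)"
    using fun_cong[OF cnj_reflect_exp_cvec[of \<zeta>]]
    by (simp only: complex_cnj_mult cnj_exp_cvec_uminus cnj_reflect_def even
        complex_cnj_complex_of_real)
  also have "\<dots> = (LINT x:ball 0 1|lborel. ?f (vcnj \<zeta>) (cgo_mu \<delta> q (vcnj \<zeta>)) x)"
    \<comment> \<open>The two representatives differ on a null set. Exchanging them under the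
      integral calls for measurable integrands, which is where measurability of \<open>q\<close>
      enters.\<close>
    unfolding set_lebesgue_integral_def
    using AE_cgo_mu_vcnj[OF even adm]
    by (intro integral_cong_AE meas borel_measurable_cnj_reflect) (auto elim: eventually_mono)
  finally show ?thesis
    by (simp only: scattering_transform_def cgo_psi_def)
qed


section \<open>The exponential approximation\<close>

text \<open>The weak equation is tested with \<open>cnj_reflect \<phi>\<close> and conjugated; the
  Laplacian commutes with the operation and the ball is symmetric.\<close>

lemma dirichlet_solution_cnj_reflect:
  assumes even: "\<forall>x. q (- x) = q x" and sol: "dirichlet_solution q f v"
  shows "dirichlet_solution q (cnj_reflect f) (cnj_reflect v)"
proof -
  have "continuous_on (cball 0 1) (cnj_reflect v)"
    unfolding cnj_reflect_def using sol
    by (intro continuous_intros continuous_on_compose2[of "cball 0 1" v _ uminus])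
      (auto simp: dirichlet_solution_def)
  moreover have "\<forall>x\<in>sphere 0 1. cnj_reflect v x = cnj_reflect f x"
    using sol by (simp add: dirichlet_solution_def cnj_reflect_def)
  moreover have "(LINT x:ball 0 1|lborel.
      cnj_reflect v x * (- laplacian \<phi> x + of_real (q x) * \<phi> x)) = 0"
    if \<phi>: "\<phi> \<in> test_functions (ball 0 1)" for \<phi>
  proof -
    let ?\<psi> = "cnj_reflect \<phi>"
    let ?I = "LINT x:ball 0 1|lborel. v x * (- laplacian ?\<psi> x + of_real (q x) * ?\<psi> x)"
    have "smooth \<phi>"
      using \<phi> by (simp add: test_functions_def)
    then have "(LINT x:ball 0 1|lborel.
        cnj_reflect v x * (- laplacian \<phi> x + of_real (q x) * \<phi> x)) = cnj ?I"
      by (subst set_lborel_integral_cnj_reflect[symmetric])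
        (simp_all add: laplacian_cnj_reflect even cnj_reflect_def)
    also have "?I = 0"
      using sol test_functions_cnj_reflect[OF \<phi>] by (simp add: dirichlet_solution_def)
    finally show ?thesis
      by simp
  qed
  ultimately show ?thesis
    by (simp add: dirichlet_solution_def)
qed

text \<open>The outward normal at \<open>-x\<close> is \<open>-x\<close>, so the inward path at
  \<open>-x\<close> is the reflection of the one at \<open>x\<close> with the same parameter. Hence
  no sign appears.\<close>

lemma has_normal_derivative_cnj_reflect:
  assumes "has_normal_derivative v d x"
  shows "has_normal_derivative (cnj_reflect v) (cnj d) (- x)"
  using has_vector_derivative_cnj[OF assms[unfolded has_normal_derivative_def]]
  by (simp add: has_normal_derivative_def cnj_reflect_def add.commute)

lemma Ex1_cnj: "(\<exists>!d. P (cnj d)) \<longleftrightarrow> (\<exists>!d. P d)"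
  by (metis complex_cnj_cnj)

text \<open>Transports the definite description in \<open>dn_map\<close> along the bijection
  \<open>cnj\<close>.\<close>

lemma The_cnj:
  assumes ex1: "\<exists>!d. P d"
  shows "(THE d. P (cnj d)) = cnj (THE d. P d)"
proof (rule the_equality)
  show "P (cnj (cnj (THE d. P d)))"
    using theI'[OF ex1] by simp
  show "d = cnj (THE d. P d)" if "P (cnj d)" for d
    using the1_equality[OF ex1 that] by simp
qed

text \<open>The condition selecting the first case of \<open>dn_map\<close> holds for
  \<open>cnj_reflect f\<close> at \<open>x\<close> exactly when it holds for \<open>f\<close> at
  \<open>-x\<close>. In the other case both values are the default 0, which conjugation
  fixes.\<close>

lemma dn_map_cnj_reflect:
  assumes even: "\<forall>x. q (- x) = q x"
  shows "dn_map q (cnj_reflect f) x = cnj (dn_map q f (- x))"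
proof -
  let ?P = "\<lambda>f x d. \<exists>v. dirichlet_solution q f v \<and> has_normal_derivative v d x"
  have dir: "?P (cnj_reflect f) (- x) (cnj d)" if "?P f x d" for f x d
    using that dirichlet_solution_cnj_reflect[OF even] has_normal_derivative_cnj_reflect by blast
  have iff: "?P (cnj_reflect f) x d \<longleftrightarrow> ?P f (- x) (cnj d)" for d
    \<comment> \<open>The converse is \<open>dir\<close> applied to the reflected data, again by
      involutivity.\<close>
    using dir[where f=f and x="- x" and d="cnj d"] dir[where f="cnj_reflect f" and x=x and d=d] by auto
  have ex1: "(\<exists>!d. ?P (cnj_reflect f) x d) \<longleftrightarrow> (\<exists>!d. ?P f (- x) d)"
    unfolding iff by (rule Ex1_cnj)
  have the: "(THE d. ?P (cnj_reflect f) x d) = cnj (THE d. ?P f (- x) d)"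
    if "\<exists>!d. ?P f (- x) d"
    unfolding iff by (rule The_cnj[OF that])
  show ?thesis
    using ex1 the by (simp add: dn_map_def)
qed

text \<open>Unlike for the scattering transform, the integrands agree at every point, so reflecting
  the surface integral is enough.\<close>

lemma cnj_scattering_exp:
  assumes even: "\<forall>x. q (- x) = q x"
  shows "cnj (scattering_exp q \<xi> \<zeta>) = scattering_exp q \<xi> (vcnj \<zeta>)"
proof -
  let ?e = "\<lambda>\<zeta> x. exp (- (\<i> * (cvec x \<bullet>\<^sub>c (cvec \<xi> + \<zeta>))))"
  let ?f = "\<lambda>\<zeta> x. exp (\<i> * (cvec x \<bullet>\<^sub>c \<zeta>))"
  let ?g = "\<lambda>\<zeta> x. ?e \<zeta> x * (dn_map q (?f \<zeta>) x - dn_map (\<lambda>_. 0) (?f \<zeta>) x)"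
  \<comment> \<open>Stated for a general even \<open>p\<close> so as to cover both \<open>q\<close>
    and the zero potential.\<close>
  have "dn_map p (?f (vcnj \<zeta>)) x = cnj (dn_map p (?f \<zeta>) (- x))" if "\<forall>x. p (- x) = p x" for p x
    unfolding cnj_reflect_exp_cvec[symmetric] by (rule dn_map_cnj_reflect[OF that])
  then have "?g (vcnj \<zeta>) x = cnj (?g \<zeta> (- x))" for x
    using even by (simp only: complex_cnj_mult complex_cnj_diff cnj_exp_cvec_uminus simp_thms)
  then show ?thesis
    using sphere_integral_cnj_reflect[of "?g \<zeta>"] by (simp only: scattering_exp_def)
qed


section \<open>Measurability of the potential\<close>

text \<open>Allows a formula for a first derivative that is known only inside the ball to be
  differentiated once more.\<close>

lemma pd_cong_open:
  assumes "open U" "x \<in> U" "\<And>y. y \<in> U \<Longrightarrow> f y = g y" "g differentiable (at x)"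
  shows "pd j f x = pd j g x"
proof -
  have "(g has_derivative frechet_derivative g (at x)) (at x)"
    using assms(4) by (simp add: frechet_derivative_works)
  then have "(f has_derivative frechet_derivative g (at x)) (at x)"
    by (rule has_derivative_transform_within_open[OF _ assms(1,2)]) (simp add: assms(3))
  then show ?thesis
    by (simp add: has_derivative_imp_pd) (simp add: pd_def)
qed

lemma
  fixes f :: "real ^ 3 \<Rightarrow> real"
  assumes "f differentiable (at x)" "f x > 0"
  shows pd_powr: "pd j (\<lambda>y. f y powr r) x = r * f x powr (r - 1) * pd j f x"
    and differentiable_powr_const: "(\<lambda>y. f y powr r) differentiable (at x)"
proof -
  obtain D where D: "(f has_derivative D) (at x)"
    using assms(1) by (auto simp: differentiable_def)
  have *: "((\<lambda>y. f y powr r) has_derivative (\<lambda>h. r * f x powr (r - 1) * D h)) (at x)"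
    using assms(2)
    by (auto intro!: derivative_eq_intros D simp: powr_diff field_simps)
  then show "(\<lambda>y. f y powr r) differentiable (at x)"
    by (auto simp: differentiable_def)
  show "pd j (\<lambda>y. f y powr r) x = r * f x powr (r - 1) * pd j f x"
    using has_derivative_imp_pd[OF *] has_derivative_imp_pd[OF D] by simp
qed

lemma pd_mult:
  fixes f g :: "real ^ 3 \<Rightarrow> real"
  assumes "f differentiable (at x)" "g differentiable (at x)"
  shows "pd j (\<lambda>y. f y * g y) x = f x * pd j g x + pd j f x * g x"
proof -
  obtain D E where D: "(f has_derivative D) (at x)" and E: "(g has_derivative E) (at x)"
    using assms by (auto simp: differentiable_def)
  show ?thesis
    using has_derivative_imp_pd[OF has_derivative_mult[OF D E]] has_derivative_imp_pd[OF D]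
      has_derivative_imp_pd[OF E] by simp
qed

text \<open>The chain rule expresses the second derivatives of the square root of
  \<open>\<gamma>\<close> through \<open>\<gamma>\<close> and its derivatives up to order two. Thus
  the potential is continuous in the open ball and zero outside, hence Borel.\<close>

lemma borel_measurable_potential:
  assumes C2: "C2_closed_ball \<gamma>" and pos: "\<And>x. x \<in> cball 0 1 \<Longrightarrow> \<gamma> x > 0"
  shows "potential \<gamma> \<in> borel_measurable borel"
proof -
  let ?B = "ball 0 1 :: (real ^ 3) set"
  have pos': "\<gamma> x > 0" if "x \<in> ?B" for x
    using that pos[of x] by simp
  have diff: "pds js \<gamma> differentiable (at x)" if "length js \<le> 1" "x \<in> ?B" for js x
    using C2[unfolded C2_closed_ball_def, THEN conjunct2, THEN conjunct1] that by blast
  have diff0: "\<gamma> differentiable (at x)" if "x \<in> ?B" for x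
    using diff[of "[]" x] that by (simp add: pds_def)
  have diff1: "pd j \<gamma> differentiable (at x)" if "x \<in> ?B" for j x
    using diff[of "[j]" x] that by (simp add: pds_def)
  have cont: "continuous_on ?B (pds js \<gamma>)" if js: "length js \<le> 2" for js
  proof -
    obtain g where g: "continuous_on (cball 0 1) g" and eq: "\<And>x. x \<in> ?B \<Longrightarrow> g x = pds js \<gamma> x"
      using C2[unfolded C2_closed_ball_def, THEN conjunct2, THEN conjunct2, rule_format, OF js]
      by blast
    show ?thesis
      by (rule continuous_on_eq[OF continuous_on_subset[OF g ball_subset_cball] eq])
  qed
  have cont_\<gamma>: "continuous_on ?B \<gamma>" "continuous_on ?B (pd j \<gamma>)"
      "continuous_on ?B (pd j (pd j \<gamma>))" for j
    using cont[of "[]"] cont[of "[j]"] cont[of "[j, j]"] by (simp_all add: pds_def)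
  \<comment> \<open>The factor of \<open>pd j \<gamma>\<close> in the first derivative of the square
    root; the exponent stays unsimplified to match \<open>pd_powr\<close>.\<close>
  let ?a = "\<lambda>x. 1 / 2 * \<gamma> x powr (1 / 2 - 1)"
  have second: "pd j (pd j (\<lambda>y. \<gamma> y powr (1 / 2))) x =
      ?a x * pd j (pd j \<gamma>) x +
      1 / 2 * ((1 / 2 - 1) * \<gamma> x powr (1 / 2 - 1 - 1) * pd j \<gamma> x) * pd j \<gamma> x"
    if x: "x \<in> ?B" for j x
  proof -
    have p: "(\<lambda>y. \<gamma> y powr (1 / 2 - 1)) differentiable (at x)"
      using differentiable_powr_const[OF diff0[OF x] pos'[OF x]] .
    have a: "?a differentiable (at x)"
      using p by (intro differentiable_mult) auto
    have "pd j (pd j (\<lambda>y. \<gamma> y powr (1 / 2))) x = pd j (\<lambda>y. ?a y * pd j \<gamma> y) x"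
    proof (rule pd_cong_open[OF open_ball x])
      show "pd j (\<lambda>y. \<gamma> y powr (1 / 2)) y = ?a y * pd j \<gamma> y" if "y \<in> ?B" for y
        by (rule pd_powr[OF diff0[OF that] pos'[OF that]])
      show "(\<lambda>y. ?a y * pd j \<gamma> y) differentiable (at x)"
        by (rule differentiable_mult[OF a diff1[OF x]])
    qed
    also have "\<dots> = ?a x * pd j (pd j \<gamma>) x + pd j ?a x * pd j \<gamma> x"
      by (rule pd_mult[OF a diff1[OF x]])
    also have "pd j ?a x = 1 / 2 * pd j (\<lambda>y. \<gamma> y powr (1 / 2 - 1)) x"
      by (subst pd_mult[OF _ p]) (simp_all add: has_derivative_imp_pd[OF has_derivative_const])
    also have "pd j (\<lambda>y. \<gamma> y powr (1 / 2 - 1)) x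
        = (1 / 2 - 1) * \<gamma> x powr (1 / 2 - 1 - 1) * pd j \<gamma> x"
      by (rule pd_powr[OF diff0[OF x] pos'[OF x]])
    finally show ?thesis .
  qed
  have "continuous_on ?B (pd j (pd j (\<lambda>y. \<gamma> y powr (1 / 2))))" for j
    by (subst continuous_on_cong[OF refl second]) (auto intro!: cont_\<gamma> continuous_intros dest: pos')
  then have "continuous_on ?B (\<lambda>x. \<gamma> x powr (- (1 / 2)) * laplacian (\<lambda>y. \<gamma> y powr (1 / 2)) x)"
    unfolding laplacian_def by (intro continuous_intros cont_\<gamma>) (auto dest: pos')
  then show ?thesis
    unfolding potential_def[abs_def]
    by (intro borel_measurable_continuous_on_if) auto
qed

theorem proposition3p2:
  fixes \<gamma> q :: "real ^ 3 \<Rightarrow> real" and \<delta> :: real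
  assumes "-1 < \<delta>" and "\<delta> < 0"
    and "C2_closed_ball \<gamma>"
    and "\<forall>x\<in>cball 0 1. \<gamma> x > 0"
    and "\<exists>U. open U \<and> sphere 0 1 \<subseteq> U \<and> (\<forall>x\<in>U \<inter> cball 0 1. \<gamma> x = 1)"
    and "q = potential \<gamma>"
    and "\<forall>x. q (- x) = q x"
  shows "\<forall>\<xi>. \<forall>\<zeta>\<in>\<V>_at \<xi>.
    (admissible \<delta> q \<zeta> \<longrightarrow>
      admissible \<delta> q (vcnj \<zeta>) \<and>
      cnj (scattering_transform \<delta> q \<xi> \<zeta>) = scattering_transform \<delta> q \<xi> (vcnj \<zeta>)) \<and>
    cnj (scattering_exp q \<xi> \<zeta>) = scattering_exp q \<xi> (vcnj \<zeta>)"
proof -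
  \<comment> \<open>Regularity and positivity of \<open>\<gamma>\<close> supply the measurability
    required by \<open>cnj_scattering_transform\<close>.\<close>
  have "q \<in> borel_measurable borel"
    using borel_measurable_potential[OF assms(3)] assms(4,6) by simp
  then show ?thesis
    using cnj_scattering_transform[OF assms(7)] admissible_vcnj[OF assms(7)]
      cnj_scattering_exp[OF assms(7)] by blast
qed

end
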